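(* Let $S$ be a set of $n\ge 3$ points on a circle, labelled circularly by $\mathbb{Z}/n\mathbb{Z}$, and let $\Gamma$ be the infinite graph with vertex set $S\times\mathbb{N}$, $\mathbb{N}=\{1,2,3,\dots\}$, in which, for every $i\in\mathbb{Z}/n\mathbb{Z}$ and every $j\in\mathbb{N}$, the vertex $(i,j)$ is joined by edges of conductivity $1$ to the two vertices $(i,j+1)$ and $(i+1,j+1)$ of the next layer (first indices taken modulo $n$), and there are no other edges. The boundary of $\Gamma$ is the first layer $S\times\{1\}$. Let $\Lambda(\Gamma)$ be the Dirichlet-to-Neumann map of $\Gamma$, regarded as an $n\times n$ matrix indexed by the boundary vertices. Then $$\Lambda^2(\Gamma) = L=\left[-\frac{\partial^2}{\partial\theta^2}\right],$$ where $L$ is the $n\times n$ matrix with $L(i,i)=2$, $L(i,i+1)=L(i,i-1)=-1$ (indices modulo $n$), and all other entries $0$, i.e. $$\Lambda^2(\Gamma)=\begin{bmatrix} 2 & -1 & 0 & \cdots & 0 & -1\\ -1 & 2 & -1 & \cdots & 0 & 0\\ 0 & -1 & 2 & \cdots & 0 & 0\\ \vdots & & & \ddots & & \vdots\\ 0 & 0 & 0 & \cdots & 2 & -1\\ -1 & 0 & 0 & \cdots & -1 & 2\end{bmatrix}.$$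
   Context: The discrete Dirichlet-to-Neumann map of a graph with edge conductivities $\gamma_{pq}$ and a designated set of boundary vertices is the linear map from boundary potential to boundary current for a potential $u$ on the vertices of the graph satisfying Kirchhoff's law $\sum_{q}\gamma_{pq}(u_p-u_q)=0$ at the non-boundary vertices $p$ (sum over neighbours $q$ of $p$); the current at a boundary vertex $p$ is $\sum_q\gamma_{pq}(u_p-u_q)$. As a matrix, the Dirichlet-to-Neumann map is the Schur complement of the Laplace matrix of the graph with respect to the block of non-boundary vertices. The notation $[-\partial^2/\partial\theta^2]$ stands for the matrix $L$, the discrete analogue of minus the Laplace operator on the boundary circle of the unit disc. The graph $\Gamma$ is $\mathbb{Z}\times\mathbb{Z}$ cut along a diagonal $x=y$ and rolled into a semi-infinite cylinder.
   Formalization: The Dirichlet-to-Neumann map is taken with bounded potentials: on this infinite graph Kirchhoff's law alone does not determine the potential (u(i,j)=j-1 vanishes on the boundary but has non-zero current); existence and uniqueness of the bounded potential are part of the claim. *)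

theory Defs
  imports Jordan_Normal_Form.Matrix "HOL-Library.FuncSet"
begin

text \<open>A graph with edge conductivities and a designated set of boundary vertices;
  \<open>cond N p q = 0\<close> means that \<open>p\<close> and \<open>q\<close> are not joined by an edge. All graphs are meant
  to be locally finite with symmetric conductivities.\<close>

record 'v network =
  verts :: "'v set"
  bdry :: "'v set"
  cond :: "'v \<Rightarrow> 'v \<Rightarrow> real"

definition nbrs :: "'v network \<Rightarrow> 'v \<Rightarrow> 'v set" where
  "nbrs N p = {q \<in> verts N. cond N p q \<noteq> 0}"

definition current :: "'v network \<Rightarrow> ('v \<Rightarrow> real) \<Rightarrow> 'v \<Rightarrow> real" where
  "current N u p = (\<Sum>q\<in>nbrs N p. cond N p q * (u p - u q))"

text \<open>On an infinite graph Kirchhoff's law and the boundary values do not determine the potential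
  (on the cylinder below the potential \<open>(i, j) \<mapsto> j - 1\<close> satisfies Kirchhoff's law and vanishes on
  the boundary), so potentials are required to be bounded; on a finite graph this is no
  restriction. Potentials are functions on the vertex set only, hence \<open>extensional\<close>.\<close>

definition dirichlet_solution :: "'v network \<Rightarrow> ('v \<Rightarrow> real) \<Rightarrow> ('v \<Rightarrow> real) \<Rightarrow> bool" where
  "dirichlet_solution N \<phi> u \<longleftrightarrow>
     u \<in> extensional (verts N) \<and>
     (\<exists>C. \<forall>p\<in>verts N. \<bar>u p\<bar> \<le> C) \<and>
     (\<forall>p\<in>bdry N. u p = \<phi> p) \<and>
     (\<forall>p\<in>verts N - bdry N. current N u p = 0)"

definition dn_map :: "'v network \<Rightarrow> ('v \<Rightarrow> real) \<Rightarrow> 'v \<Rightarrow> real" where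
  "dn_map N \<phi> = restrict (current N (THE u. dirichlet_solution N \<phi> u)) (bdry N)"

text \<open>The residues modulo \<open>n\<close> are represented by \<open>{0..<n}\<close>, the layers are numbered from 1.\<close>

definition cyl_succ :: "nat \<Rightarrow> nat \<times> nat \<Rightarrow> nat \<times> nat \<Rightarrow> bool" where
  "cyl_succ n p q \<longleftrightarrow>
     snd q = snd p + 1 \<and> (fst q = fst p \<or> fst q = (fst p + 1) mod n)"

definition cylinder :: "nat \<Rightarrow> (nat \<times> nat) network" where
  "cylinder n =
     \<lparr> verts = {0..<n} \<times> {1..},
       bdry = {0..<n} \<times> {1},
       cond = (\<lambda>p q. if cyl_succ n p q \<or> cyl_succ n q p then 1 else 0) \<rparr>"

text \<open>The matrix of \<open>dn_map (cylinder n)\<close> in the basis of unit potentials at the boundary vertices.\<close>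

definition dn_matrix :: "nat \<Rightarrow> real mat" where
  "dn_matrix n =
     mat n n (\<lambda>(i, k). dn_map (cylinder n) (\<lambda>p. if p = (k, 1) then 1 else 0) (i, 1))"

definition circle_laplacian :: "nat \<Rightarrow> real mat" where
  "circle_laplacian n =
     mat n n (\<lambda>(i, k). if k = i then 2
                       else if k = (i + 1) mod n \<or> i = (k + 1) mod n then - 1
                       else 0)"

end

theory Submission
  imports Defs
begin

text \<open>The square root of the circle Laplacian appears because the cylinder looks the same from
  every layer. Write \<open>u\<^sub>j\<close> for the restriction of a potential to layer \<open>j\<close>, \<open>E\<close> for the rotation
  \<open>(E f) i = f (i + 1)\<close> and \<open>A = 1 + E\<close>, with transpose \<open>A\<^sup>T = 1 + E\<^sup>-\<^sup>1\<close>. Kirchhoff's law reads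
  \<open>4 u\<^sub>j = A u\<^bsub>j+1\<^esub> + A\<^sup>T u\<^bsub>j-1\<^esub>\<close> for \<open>j \<ge> 2\<close>, and the boundary current is \<open>2 u\<^sub>1 - A u\<^sub>2\<close>.

  Let \<open>u\<close> be the bounded potential with boundary values \<open>\<phi>\<close>, and let \<open>v\<^sub>j = 2 u\<^sub>j - A u\<^bsub>j+1\<^esub>\<close>
  (\<open>inward_current\<close>). As \<open>A\<close> and \<open>A\<^sup>T\<close> commute, \<open>v\<close> satisfies Kirchhoff's law again, it is
  bounded, and its boundary values are \<open>v\<^sub>1 = \<Lambda> \<phi>\<close>. So \<open>v\<close> is the solution with boundary values
  \<open>\<Lambda> \<phi>\<close>, and
  \<open>\<Lambda>\<^sup>2 \<phi> = 2 v\<^sub>1 - A v\<^sub>2 = 4 u\<^sub>1 - 4 A u\<^sub>2 + A\<^sup>2 u\<^sub>3\<close>. Applying \<open>A\<close> to Kirchhoff's law in the second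
  layer turns this into \<open>4 u\<^sub>1 - A A\<^sup>T u\<^sub>1 = (2 - E - E\<^sup>-\<^sup>1) u\<^sub>1\<close>, which is \<open>L \<phi>\<close>. The computation is
  contained in \<open>kirchhoff_inward_current\<close> and \<open>boundary_current_inward_current\<close>.

  This uses that the bounded Dirichlet problem is well posed. Existence holds on every locally
  finite network with nonnegative conductivities, by a monotone iteration
  (\<open>dirichlet_solution_exists\<close>). For uniqueness, the maxima of \<open>\<bar>w\<bar>\<close> over the layers of a
  potential \<open>w\<close> satisfying Kirchhoff's law form a convex sequence, and a bounded convex sequence
  cannot exceed its initial value; the initial value is \<open>0\<close> if \<open>w\<close> vanishes on the boundary
  (\<open>bounded_kirchhoff_zero\<close>).\<close>

section \<open>The Dirichlet problem on a locally finite network\<close>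

lemma current_cong:
  assumes "\<And>q. q \<in> verts N \<Longrightarrow> u q = v q" and "p \<in> verts N"
  shows "current N u p = current N v p"
  unfolding current_def using assms by (intro sum.cong) (auto simp: nbrs_def)

lemma current_diff:
  "current N (\<lambda>q. u q - v q) p = current N u p - current N v p"
  unfolding current_def by (simp add: sum_subtractf[symmetric] algebra_simps)

lemma current_linear_combination:
  "current N (\<lambda>q. \<Sum>k\<in>K. c k * u k q) p = (\<Sum>k\<in>K. c k * current N (u k) p)"
proof -
  have "current N (\<lambda>q. \<Sum>k\<in>K. c k * u k q) p =
      (\<Sum>q\<in>nbrs N p. \<Sum>k\<in>K. c k * (cond N p q * (u k p - u k q)))"
    unfolding current_def
    by (simp add: sum_subtractf[symmetric] sum_distrib_left algebra_simps)
  also have "\<dots> = (\<Sum>k\<in>K. c k * current N (u k) p)"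
    by (subst sum.swap) (simp add: current_def sum_distrib_left)
  finally show ?thesis .
qed

lemma dirichlet_solution_restrict:
  assumes "bdry N \<subseteq> verts N"
    and "\<And>p. p \<in> verts N \<Longrightarrow> \<bar>u p\<bar> \<le> C"
    and "\<And>p. p \<in> bdry N \<Longrightarrow> u p = \<phi> p"
    and "\<And>p. p \<in> verts N - bdry N \<Longrightarrow> current N u p = 0"
  shows "dirichlet_solution N \<phi> (restrict u (verts N))"
proof -
  have "current N (restrict u (verts N)) p = current N u p" if "p \<in> verts N" for p
    using that by (intro current_cong) auto
  then show ?thesis
    unfolding dirichlet_solution_def using assms by (auto intro!: exI[of _ C])
qed

text \<open>One step of relaxation: each interior value is replaced by the weighted mean of the
  neighbouring ones, so that a fixed point satisfies Kirchhoff's law and has boundary values \<open>\<phi>\<close>.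
  At an isolated interior vertex the quotient is \<open>0 / 0 = 0\<close>, which is harmless, since Kirchhoff's
  law is void there.\<close>

definition relax :: "'v network \<Rightarrow> ('v \<Rightarrow> real) \<Rightarrow> ('v \<Rightarrow> real) \<Rightarrow> 'v \<Rightarrow> real" where
  "relax N \<phi> u p = (if p \<in> bdry N then \<phi> p
     else (\<Sum>q\<in>nbrs N p. cond N p q * u q) / (\<Sum>q\<in>nbrs N p. cond N p q))"

lemma relax_mono:
  assumes "\<And>p q. cond N p q \<ge> 0" and "\<And>q. q \<in> verts N \<Longrightarrow> u q \<le> v q"
  shows "relax N \<phi> u p \<le> relax N \<phi> v p"
  unfolding relax_def using assms
  by (auto intro!: divide_right_mono sum_mono mult_left_mono sum_nonneg simp: nbrs_def)

text \<open>The constant \<open>C\<close> relaxes to something no larger, and relaxation is monotone; so the iterates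
  starting at \<open>C\<close> decrease. They stay above \<open>- C\<close> by the same comparison from below, hence
  converge pointwise, and the limit is a fixed point because every vertex has only finitely
  many neighbours.\<close>

lemma dirichlet_solution_exists:
  assumes fin: "\<And>p. p \<in> verts N \<Longrightarrow> finite (nbrs N p)"
    and nonneg: "\<And>p q. cond N p q \<ge> 0"
    and sub: "bdry N \<subseteq> verts N"
    and bdd: "\<And>p. p \<in> bdry N \<Longrightarrow> \<bar>\<phi> p\<bar> \<le> C" and C: "C \<ge> 0"
  shows "\<exists>u. dirichlet_solution N \<phi> u"
proof -
  define U where "U k = (relax N \<phi> ^^ k) (\<lambda>_. C)" for k
  have U_Suc: "U (Suc k) = relax N \<phi> (U k)" for k
    by (simp add: U_def)
  have relax_const: "\<bar>relax N \<phi> (\<lambda>_. c) p\<bar> \<le> C" if "\<bar>c\<bar> = C" for c p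
  proof (cases "p \<in> bdry N")
    case False
    then show ?thesis
      using that C by (simp add: relax_def sum_distrib_right[symmetric] abs_mult)
  qed (simp add: relax_def bdd)
  have dec: "U (Suc k) p \<le> U k p" for k p
  proof (induction k arbitrary: p)
    case 0
    show ?case using relax_const[of C p] C by (simp add: U_def)
  next
    case (Suc k)
    show ?case unfolding U_Suc[of "Suc k"] U_Suc[of k]
      using nonneg Suc by (intro relax_mono) (auto simp: U_Suc)
  qed
  have lower: "- C \<le> U k p" for k p
  proof (induction k arbitrary: p)
    case 0
    show ?case using C by (simp add: U_def)
  next
    case (Suc k)
    have "- C \<le> relax N \<phi> (\<lambda>_. - C) p"
      using relax_const[of "- C" p] C by simp
    also have "\<dots> \<le> relax N \<phi> (U k) p"
      using nonneg Suc by (intro relax_mono) auto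
    finally show ?case by (simp add: U_Suc)
  qed
  have decU: "decseq (\<lambda>k. U k p)" for p
    using dec by (intro decseq_SucI)
  have upper: "U k p \<le> C" for k p
    using decseqD[OF decU[of p], of 0 k] by (simp add: U_def)
  have "\<exists>x. (\<lambda>k. U k p) \<longlonglongrightarrow> x" for p
    by (rule decseq_convergent[OF decU[of p], of "- C"]) (auto simp: lower)
  then obtain u where lim: "(\<lambda>k. U k p) \<longlonglongrightarrow> u p" for p
    by metis
  have abs_u: "\<bar>u p\<bar> \<le> C" for p
  proof -
    have "- C \<le> u p" by (rule LIMSEQ_le_const[OF lim]) (simp add: lower)
    moreover have "u p \<le> C" by (rule LIMSEQ_le_const2[OF lim]) (simp add: upper)
    ultimately show ?thesis by simp
  qed
  have fix_u: "u p = relax N \<phi> u p" if "p \<in> verts N" for p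
  proof (rule LIMSEQ_unique)
    show "(\<lambda>k. U (Suc k) p) \<longlonglongrightarrow> u p"
      using lim[of p] by (rule LIMSEQ_Suc)
    show "(\<lambda>k. U (Suc k) p) \<longlonglongrightarrow> relax N \<phi> u p"
      unfolding U_Suc relax_def divide_inverse
      by (cases "p \<in> bdry N") (auto intro!: tendsto_intros lim)
  qed
  have "current N u p = 0" if p: "p \<in> verts N - bdry N" for p
  proof -
    let ?c = "\<Sum>q\<in>nbrs N p. cond N p q"
    have cur: "current N u p = ?c * u p - (\<Sum>q\<in>nbrs N p. cond N p q * u q)"
      by (simp add: current_def right_diff_distrib sum_subtractf sum_distrib_right)
    show ?thesis
    proof (cases "?c = 0")
      case True
      then have "cond N p q = 0" if "q \<in> nbrs N p" for q
        using sum_nonneg_eq_0_iff[of "nbrs N p" "cond N p"] fin nonneg p that by auto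
      then show ?thesis by (simp add: current_def)
    next
      case False
      have "u p = (\<Sum>q\<in>nbrs N p. cond N p q * u q) / ?c"
        using fix_u[of p] p by (simp add: relax_def)
      then show ?thesis using False by (simp add: cur field_simps)
    qed
  qed
  moreover have "u p = \<phi> p" if "p \<in> bdry N" for p
    using fix_u[of p] sub that by (auto simp: relax_def)
  ultimately show ?thesis
    using dirichlet_solution_restrict[OF sub, of u C \<phi>] abs_u by blast
qed

section \<open>Currents on the cylinder\<close>

text \<open>The predecessor is written \<open>i + n - 1\<close> since subtraction on \<open>nat\<close> truncates at \<open>i = 0\<close>.\<close>

definition rot_succ :: "nat \<Rightarrow> nat \<Rightarrow> nat" where
  "rot_succ n i = (i + 1) mod n"

definition rot_pred :: "nat \<Rightarrow> nat \<Rightarrow> nat" where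
  "rot_pred n i = (i + n - 1) mod n"

lemma rot_succ_cases: "i < n \<Longrightarrow> rot_succ n i = (if i + 1 = n then 0 else i + 1)"
  by (auto simp: rot_succ_def)

lemma rot_pred_cases: "i < n \<Longrightarrow> rot_pred n i = (if i = 0 then n - 1 else i - 1)"
  by (auto simp: rot_pred_def mod_if)

lemma rot_less [simp]: "i < n \<Longrightarrow> rot_succ n i < n" "i < n \<Longrightarrow> rot_pred n i < n"
  by (simp_all add: rot_succ_def rot_pred_def)

lemma rot_pred_succ: "i < n \<Longrightarrow> rot_pred n (rot_succ n i) = i"
  by (subst rot_pred_cases) (auto simp: rot_succ_cases)

lemma rot_succ_pred: "i < n \<Longrightarrow> rot_succ n (rot_pred n i) = i"
  by (subst rot_succ_cases) (auto simp: rot_pred_cases)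

lemma cylinder_simps [simp]:
  "verts (cylinder n) = {0..<n} \<times> {1..}"
  "bdry (cylinder n) = {0..<n} \<times> {1}"
  by (simp_all add: cylinder_def)

lemma rot_succ_eq_iff_pred:
  assumes "i < n" "k < n"
  shows "i = rot_succ n k \<longleftrightarrow> k = rot_pred n i"
  using assms rot_pred_succ rot_succ_pred by metis

lemma cond_cylinder:
  "cond (cylinder n) (i, j) (k, l) =
    (if l = j + 1 \<and> (k = i \<or> k = rot_succ n i) \<or> j = l + 1 \<and> (i = k \<or> i = rot_succ n k)
     then 1 else 0)"
  by (auto simp: cylinder_def cyl_succ_def rot_succ_def)

lemma nbrs_boundary:
  assumes "i < n"
  shows "nbrs (cylinder n) (i, Suc 0) = {(i, 2), (rot_succ n i, 2)}"
  using assms by (auto simp: nbrs_def cond_cylinder split: if_splits)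

lemma nbrs_interior:
  assumes "i < n"
  shows "nbrs (cylinder n) (i, Suc (Suc j)) =
    {(i, Suc (Suc (Suc j))), (rot_succ n i, Suc (Suc (Suc j))), (i, Suc j), (rot_pred n i, Suc j)}"
  using assms rot_succ_eq_iff_pred[OF assms]
  by (auto simp: nbrs_def cond_cylinder split: if_splits)

lemma current_boundary:
  assumes "n \<ge> 2" "i < n"
  shows "current (cylinder n) u (i, Suc 0) = 2 * u (i, Suc 0) - u (i, 2) - u (rot_succ n i, 2)"
proof -
  have "i \<noteq> rot_succ n i" using assms by (auto simp: rot_succ_cases)
  then show ?thesis
    unfolding current_def nbrs_boundary[OF assms(2)]
    by (auto simp: cond_cylinder)
qed

lemma current_interior:
  assumes "n \<ge> 2" "i < n"
  shows "current (cylinder n) u (i, Suc (Suc j)) =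
    4 * u (i, Suc (Suc j)) - u (i, Suc (Suc (Suc j))) - u (rot_succ n i, Suc (Suc (Suc j)))
      - u (i, Suc j) - u (rot_pred n i, Suc j)"
proof -
  have "i \<noteq> rot_succ n i" "i \<noteq> rot_pred n i"
    using assms rot_succ_cases[of i n] rot_pred_cases[of i n] by auto
  moreover have "rot_succ n (rot_pred n i) = i" using assms by (simp only: rot_succ_pred)
  ultimately show ?thesis
    unfolding current_def nbrs_interior[OF assms(2)]
    by (auto simp: cond_cylinder)
qed

lemma kirchhoff_cylinder_iff:
  assumes "n \<ge> 2"
  shows "(\<forall>p \<in> verts (cylinder n) - bdry (cylinder n). current (cylinder n) u p = 0) \<longleftrightarrow>
    (\<forall>i<n. \<forall>j. 4 * u (i, Suc (Suc j)) =
       u (i, Suc (Suc (Suc j))) + u (rot_succ n i, Suc (Suc (Suc j)))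
         + u (i, Suc j) + u (rot_pred n i, Suc j))"
    (is "?L \<longleftrightarrow> ?R")
proof
  assume L: ?L
  show ?R
  proof (intro allI impI)
    fix i j assume "i < n"
    then show "4 * u (i, Suc (Suc j)) =
       u (i, Suc (Suc (Suc j))) + u (rot_succ n i, Suc (Suc (Suc j)))
         + u (i, Suc j) + u (rot_pred n i, Suc j)"
      using L[rule_format, of "(i, Suc (Suc j))"] current_interior[OF assms, of i u j] by simp
  qed
next
  assume R: ?R
  show ?L
  proof
    fix p assume p: "p \<in> verts (cylinder n) - bdry (cylinder n)"
    then have "fst p < n" "snd p = Suc (Suc (snd p - 2))" by auto
    then obtain i j where "p = (i, Suc (Suc j))" "i < n" by (metis prod.collapse)
    then show "current (cylinder n) u p = 0"
      using R[rule_format, of i j] current_interior[OF assms, of i u j] by simp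
  qed
qed

section \<open>Well-posedness on the cylinder\<close>

lemma bounded_convex_le_initial:
  fixes f :: "nat \<Rightarrow> real"
  assumes convex: "\<And>j. 2 * f (Suc j) \<le> f (Suc (Suc j)) + f j" and bdd: "\<And>j. f j \<le> B"
  shows "f j \<le> f 0"
proof -
  have "f (Suc j) \<le> f j" for j
  proof (rule ccontr)
    define d where "d = f (Suc j) - f j"
    assume "\<not> f (Suc j) \<le> f j"
    then have "d > 0" by (simp add: d_def)
    have step: "d \<le> f (Suc (j + k)) - f (j + k)" for k
    proof (induction k)
      case (Suc k)
      then show ?case using convex[of "j + k"] by simp
    qed (simp add: d_def)
    have grow: "f j + real k * d \<le> f (j + k)" for k
    proof (induction k)
      case (Suc k)
      then show ?case using step[of k] by (simp add: algebra_simps)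
    qed simp
    obtain k where "B - f j < real k * d"
      using reals_Archimedean3[OF \<open>d > 0\<close>] by blast
    then show False using grow[of k] bdd[of "j + k"] by linarith
  qed
  then have "decseq f" by (rule decseq_SucI)
  then show ?thesis by (rule decseqD) simp
qed

text \<open>By Kirchhoff's law an interior value is the mean of two values in the next layer and two in
  the previous one, so the maximum of \<open>\<bar>w\<bar>\<close> over a layer is at most the mean of the maxima over the
  two adjacent layers.\<close>

lemma bounded_kirchhoff_zero:
  assumes n: "n \<ge> 2"
    and bdd: "\<And>i j. i < n \<Longrightarrow> \<bar>w (i, Suc j)\<bar> \<le> B"
    and zero: "\<And>i. i < n \<Longrightarrow> w (i, Suc 0) = 0"
    and kirchhoff: "\<And>p. p \<in> verts (cylinder n) - bdry (cylinder n) \<Longrightarrow> current (cylinder n) w p = 0"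
    and i: "i < n"
  shows "w (i, Suc j) = 0"
proof -
  define M where "M j = Max ((\<lambda>i. \<bar>w (i, Suc j)\<bar>) ` {0..<n})" for j
  have le_M: "\<bar>w (i, Suc j)\<bar> \<le> M j" if "i < n" for i j
    unfolding M_def using that by (intro Max_ge) auto
  have M_le: "M j \<le> b" if "\<And>i. i < n \<Longrightarrow> \<bar>w (i, Suc j)\<bar> \<le> b" for j b
    unfolding M_def using that n by (subst Max_le_iff) auto
  have "2 * M (Suc j) \<le> M (Suc (Suc j)) + M j" for j
  proof -
    have "2 * \<bar>w (i, Suc (Suc j))\<bar> \<le> M (Suc (Suc j)) + M j" if i: "i < n" for i
    proof -
      have "4 * w (i, Suc (Suc j)) =
          w (i, Suc (Suc (Suc j))) + w (rot_succ n i, Suc (Suc (Suc j)))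
            + w (i, Suc j) + w (rot_pred n i, Suc j)"
        using kirchhoff_cylinder_iff[OF n, of w] kirchhoff i by blast
      then show ?thesis
        using le_M[OF i, of "Suc (Suc j)"] le_M[OF rot_less(1)[OF i], of "Suc (Suc j)"]
          le_M[OF i, of j] le_M[OF rot_less(2)[OF i], of j] by linarith
    qed
    then show ?thesis using M_le[of "Suc j" "(M (Suc (Suc j)) + M j) / 2"]
      by (simp add: mult.commute)
  qed
  moreover have "M j \<le> B" for j
    using bdd by (rule M_le)
  ultimately have "M j \<le> M 0" by (rule bounded_convex_le_initial)
  also have "M 0 \<le> 0" using zero by (intro M_le) simp
  finally show ?thesis using le_M[OF i, of j] by simp
qed

lemma dirichlet_solution_unique:
  assumes n: "n \<ge> 2"
    and u: "dirichlet_solution (cylinder n) \<phi> u" and v: "dirichlet_solution (cylinder n) \<phi> v"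
  shows "u = v"
proof -
  obtain B C where B: "\<And>p. p \<in> verts (cylinder n) \<Longrightarrow> \<bar>u p\<bar> \<le> B"
    and C: "\<And>p. p \<in> verts (cylinder n) \<Longrightarrow> \<bar>v p\<bar> \<le> C"
    using u v unfolding dirichlet_solution_def by metis
  have zero: "u (i, Suc j) - v (i, Suc j) = 0" if "i < n" for i j
  proof (rule bounded_kirchhoff_zero[OF n, where w = "\<lambda>p. u p - v p" and B = "B + C"])
    show "\<bar>u (i, Suc j) - v (i, Suc j)\<bar> \<le> B + C" if "i < n" for i j
      using B[of "(i, Suc j)"] C[of "(i, Suc j)"] that by auto
    show "u (i, Suc 0) - v (i, Suc 0) = 0" if "i < n" for i
      using u v that by (auto simp: dirichlet_solution_def)
    show "current (cylinder n) (\<lambda>p. u p - v p) p = 0"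
      if "p \<in> verts (cylinder n) - bdry (cylinder n)" for p
      using u v that by (simp only: current_diff) (simp add: dirichlet_solution_def)
  qed (fact that)
  show ?thesis
  proof (rule extensionalityI)
    show "u \<in> extensional (verts (cylinder n))" "v \<in> extensional (verts (cylinder n))"
      using u v by (auto simp only: dirichlet_solution_def)
    show "u p = v p" if p: "p \<in> verts (cylinder n)" for p
    proof -
      have "fst p < n" "snd p = Suc (snd p - 1)" using p by auto
      then show ?thesis using zero[of "fst p" "snd p - 1"] by (metis eq_iff_diff_eq_0 prod.collapse)
    qed
  qed
qed

lemma cylinder_well_posed:
  assumes n: "n \<ge> 2"
  shows "\<exists>!u. dirichlet_solution (cylinder n) \<phi> u"
proof -
  define C where "C = (\<Sum>i<n. \<bar>\<phi> (i, 1)\<bar>)"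
  have "\<exists>u. dirichlet_solution (cylinder n) \<phi> u"
  proof (rule dirichlet_solution_exists)
    show "finite (nbrs (cylinder n) p)" if p: "p \<in> verts (cylinder n)" for p
    proof -
      obtain i j where ij: "p = (i, Suc j)" "i < n"
        using p by (cases p, cases "snd p") auto
      then show ?thesis by (cases j) (simp_all add: nbrs_boundary nbrs_interior)
    qed
    show "\<bar>\<phi> p\<bar> \<le> C" if "p \<in> bdry (cylinder n)" for p
      using that unfolding C_def
      by (auto intro!: member_le_sum[where f = "\<lambda>i. \<bar>\<phi> (i, Suc 0)\<bar>"])
    show "0 \<le> C" by (simp add: C_def sum_nonneg)
  qed (auto simp: cylinder_def)
  then show ?thesis using dirichlet_solution_unique[OF n] by blast
qed

section \<open>The Dirichlet-to-Neumann map and its square\<close>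

lemma dn_map_eq_current:
  assumes "n \<ge> 2" "dirichlet_solution (cylinder n) \<phi> u" "i < n"
  shows "dn_map (cylinder n) \<phi> (i, 1) = current (cylinder n) u (i, 1)"
proof -
  have "(THE u. dirichlet_solution (cylinder n) \<phi> u) = u"
    using assms dirichlet_solution_unique by (intro the_equality) auto
  then show ?thesis using assms by (simp add: dn_map_def)
qed

abbreviation unit_potential :: "nat \<Rightarrow> nat \<times> nat \<Rightarrow> real" where
  "unit_potential k \<equiv> \<lambda>p. if p = (k, 1) then 1 else 0"

text \<open>This is linearity of the Dirichlet-to-Neumann map: the superposition of the solutions for the
  unit potentials solves the Dirichlet problem for \<open>\<phi>\<close>.\<close>

lemma dn_map_eq_dn_matrix_mult:
  assumes n: "n \<ge> 2" and i: "i < n"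
  shows "dn_map (cylinder n) \<phi> (i, 1) = (\<Sum>k<n. dn_matrix n $$ (i, k) * \<phi> (k, 1))"
proof -
  have "\<exists>u. dirichlet_solution (cylinder n) (unit_potential k) u" for k
    using cylinder_well_posed[OF n] by blast
  then obtain u where u: "\<And>k. dirichlet_solution (cylinder n) (unit_potential k) (u k)"
    by metis
  define s where "s q = (\<Sum>k<n. \<phi> (k, 1) * u k q)" for q
  have "\<exists>C. \<forall>p\<in>verts (cylinder n). \<bar>u k p\<bar> \<le> C" for k
    using u[of k] by (simp add: dirichlet_solution_def)
  then obtain C where C: "\<And>k p. p \<in> verts (cylinder n) \<Longrightarrow> \<bar>u k p\<bar> \<le> C k"
    by metis
  have cur: "current (cylinder n) s p = (\<Sum>k<n. \<phi> (k, 1) * current (cylinder n) (u k) p)" for p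
    unfolding s_def by (rule current_linear_combination)
  have "dirichlet_solution (cylinder n) \<phi> (restrict s (verts (cylinder n)))"
  proof (rule dirichlet_solution_restrict)
    show "\<bar>s p\<bar> \<le> (\<Sum>k<n. \<bar>\<phi> (k, 1)\<bar> * C k)" if "p \<in> verts (cylinder n)" for p
      unfolding s_def using C[OF that]
      by (intro order.trans[OF sum_abs] sum_mono) (simp add: abs_mult mult_left_mono)
    show "s p = \<phi> p" if p: "p \<in> bdry (cylinder n)" for p
    proof -
      obtain i where ip: "p = (i, 1)" "i < n" using p by auto
      have "u k p = (if k = i then 1 else 0)" for k
        using u[of k] p ip by (auto simp: dirichlet_solution_def)
      then have "s p = (\<Sum>k<n. if k = i then \<phi> (k, 1) else 0)"
        unfolding s_def by (intro sum.cong) auto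
      then show ?thesis using ip by simp
    qed
    show "current (cylinder n) s p = 0" if "p \<in> verts (cylinder n) - bdry (cylinder n)" for p
      unfolding cur using u that by (simp add: dirichlet_solution_def)
  qed auto
  then have "dn_map (cylinder n) \<phi> (i, 1) =
      current (cylinder n) (restrict s (verts (cylinder n))) (i, 1)"
    using dn_map_eq_current n i by blast
  also have "\<dots> = current (cylinder n) s (i, 1)"
    using i by (intro current_cong) auto
  also have "\<dots> = (\<Sum>k<n. dn_matrix n $$ (i, k) * \<phi> (k, 1))"
    unfolding cur using dn_map_eq_current[OF n u i] i
    by (intro sum.cong) (simp_all add: dn_matrix_def)
  finally show ?thesis .
qed

text \<open>The total current from a vertex into the next layer, i.e. the boundary current of the
  cylinder that remains when all previous layers are removed.\<close>

definition inward_current :: "nat \<Rightarrow> (nat \<times> nat \<Rightarrow> real) \<Rightarrow> nat \<times> nat \<Rightarrow> real" where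
  "inward_current n u = (\<lambda>(i, j). 2 * u (i, j) - u (i, Suc j) - u (rot_succ n i, Suc j))"

text \<open>The operator \<open>2 - A S\<close>, with \<open>S\<close> the shift by one layer, commutes with the operator of
  Kirchhoff's law: the defect of \<open>inward_current n u\<close> at \<open>(i, j)\<close> is the corresponding combination
  of the defects of \<open>u\<close> at \<open>(i, j)\<close>, \<open>(i, j + 1)\<close> and \<open>(i + 1, j + 1)\<close>.\<close>

lemma kirchhoff_inward_current:
  assumes n: "n \<ge> 2"
    and kirchhoff: "\<forall>p \<in> verts (cylinder n) - bdry (cylinder n). current (cylinder n) u p = 0"
  shows "\<forall>p \<in> verts (cylinder n) - bdry (cylinder n).
    current (cylinder n) (inward_current n u) p = 0"
  unfolding kirchhoff_cylinder_iff[OF n]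
proof (intro allI impI)
  fix i j assume i: "i < n"
  let ?s = "rot_succ n i" and ?p = "rot_pred n i"
  have s: "?s < n" using i by simp
  note K = kirchhoff[unfolded kirchhoff_cylinder_iff[OF n], rule_format]
  have ps: "rot_pred n ?s = i" and sp: "rot_succ n ?p = i"
    using i by (simp_all add: rot_pred_succ rot_succ_pred)
  show "4 * inward_current n u (i, Suc (Suc j)) =
      inward_current n u (i, Suc (Suc (Suc j))) + inward_current n u (?s, Suc (Suc (Suc j)))
        + inward_current n u (i, Suc j) + inward_current n u (?p, Suc j)"
    unfolding inward_current_def prod.case sp
    using K[OF i, of j] K[OF i, of "Suc j"] K[OF s, of "Suc j", unfolded ps]
    by (simp add: algebra_simps)
qed

lemma boundary_current_inward_current:
  assumes n: "n \<ge> 2"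
    and kirchhoff: "\<forall>p \<in> verts (cylinder n) - bdry (cylinder n). current (cylinder n) u p = 0"
    and i: "i < n"
  shows "current (cylinder n) (inward_current n u) (i, 1) =
    2 * u (i, 1) - u (rot_succ n i, 1) - u (rot_pred n i, 1)"
proof -
  let ?s = "rot_succ n i"
  have s: "?s < n" using i by simp
  note K = kirchhoff[unfolded kirchhoff_cylinder_iff[OF n], rule_format]
  have ps: "rot_pred n ?s = i" using i by (rule rot_pred_succ)
  show ?thesis
    unfolding One_nat_def current_boundary[OF n i] inward_current_def prod.case numeral_2_eq_2
    using K[OF i, of 0] K[OF s, of 0, unfolded ps]
    by (simp add: algebra_simps)
qed

text \<open>If \<open>u\<close> is the bounded solution for \<open>\<phi>\<close>, then \<open>inward_current n u\<close> is the one for \<open>\<Lambda> \<phi>\<close>: in the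
  first layer it is the boundary current of \<open>u\<close>. So the second application of the map reads off
  the boundary current of \<open>inward_current n u\<close>.\<close>

lemma dn_map_dn_map:
  assumes n: "n \<ge> 2" and i: "i < n"
  shows "dn_map (cylinder n) (dn_map (cylinder n) \<phi>) (i, 1) =
    2 * \<phi> (i, 1) - \<phi> (rot_succ n i, 1) - \<phi> (rot_pred n i, 1)"
proof -
  obtain u where u: "dirichlet_solution (cylinder n) \<phi> u"
    using cylinder_well_posed[OF n] by blast
  let ?N = "cylinder n" and ?v = "inward_current n u"
  obtain C where C: "\<And>p. p \<in> verts ?N \<Longrightarrow> \<bar>u p\<bar> \<le> C"
    using u by (auto simp only: dirichlet_solution_def)
  have K: "\<forall>p \<in> verts ?N - bdry ?N. current ?N u p = 0"
    using u unfolding dirichlet_solution_def by blast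
  have bdry_u: "u (k, 1) = \<phi> (k, 1)" if "k < n" for k
    using u that by (simp add: dirichlet_solution_def)
  have "dirichlet_solution ?N (dn_map ?N \<phi>) (restrict ?v (verts ?N))"
  proof (rule dirichlet_solution_restrict)
    show "\<bar>?v p\<bar> \<le> 4 * C" if p: "p \<in> verts ?N" for p
    proof -
      obtain k j where kj: "p = (k, j)" "k < n" "j \<ge> 1" using p by auto
      then show ?thesis
        using C[of "(k, j)"] C[of "(k, Suc j)"] C[of "(rot_succ n k, Suc j)"] n
        by (simp add: inward_current_def)
    qed
    show "?v p = dn_map ?N \<phi> p" if p: "p \<in> bdry ?N" for p
    proof -
      obtain k where k: "p = (k, 1)" "k < n" using p by auto
      show ?thesis
        using dn_map_eq_current[OF n u k(2)] current_boundary[OF n k(2)] k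
        by (simp add: inward_current_def numeral_2_eq_2)
    qed
    show "current ?N ?v p = 0" if "p \<in> verts ?N - bdry ?N" for p
      using kirchhoff_inward_current[OF n K] that by blast
  qed auto
  then have "dn_map ?N (dn_map ?N \<phi>) (i, 1) = current ?N (restrict ?v (verts ?N)) (i, 1)"
    using dn_map_eq_current n i by blast
  also have "\<dots> = current ?N ?v (i, 1)"
    using i by (intro current_cong) auto
  also have "\<dots> = 2 * \<phi> (i, 1) - \<phi> (rot_succ n i, 1) - \<phi> (rot_pred n i, 1)"
    unfolding boundary_current_inward_current[OF n K i]
    using bdry_u i n by simp
  finally show ?thesis .
qed

theorem theorem4p1:
  fixes n :: nat
  assumes "n \<ge> 3"
  shows "(\<forall>\<phi>. \<exists>!u. dirichlet_solution (cylinder n) \<phi> u) \<and>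
         dn_matrix n ^\<^sub>m 2 = circle_laplacian n"
proof
  have n: "n \<ge> 2" using assms by simp
  show "\<forall>\<phi>. \<exists>!u. dirichlet_solution (cylinder n) \<phi> u"
    using cylinder_well_posed[OF n] by blast
  have carrier: "dn_matrix n \<in> carrier_mat n n" by (simp add: dn_matrix_def)
  have "dn_matrix n * dn_matrix n = circle_laplacian n"
  proof (rule eq_matI)
    fix i l assume "i < dim_row (circle_laplacian n)" "l < dim_col (circle_laplacian n)"
    then have i: "i < n" and l: "l < n" by (simp_all add: circle_laplacian_def)
    have "(dn_matrix n * dn_matrix n) $$ (i, l) =
        (\<Sum>k<n. dn_matrix n $$ (i, k) * dn_matrix n $$ (k, l))"
      using carrier i l by (simp add: scalar_prod_def atLeast0LessThan)
    also have "\<dots> = (\<Sum>k<n. dn_matrix n $$ (i, k) *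
        dn_map (cylinder n) (unit_potential l) (k, 1))"
      using l by (intro sum.cong) (simp_all add: dn_matrix_def)
    also have "\<dots> = dn_map (cylinder n) (dn_map (cylinder n) (unit_potential l)) (i, 1)"
      by (rule dn_map_eq_dn_matrix_mult[OF n i, symmetric])
    also have "\<dots> = 2 * unit_potential l (i, 1) - unit_potential l (rot_succ n i, 1)
        - unit_potential l (rot_pred n i, 1)"
      by (rule dn_map_dn_map[OF n i])
    also have "\<dots> = circle_laplacian n $$ (i, l)"
    proof -
      \<comment> \<open>This is where \<open>n \<ge> 3\<close> enters: for \<open>n = 2\<close> both neighbours of \<open>i\<close> on the circle coincide.\<close>
      have "rot_succ n i \<noteq> i" "rot_pred n i \<noteq> i" "rot_succ n i \<noteq> rot_pred n i"
        using assms i rot_succ_cases[OF i] rot_pred_cases[OF i] by auto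
      then show ?thesis
        using rot_succ_eq_iff_pred[OF i l] i l by (auto simp: circle_laplacian_def rot_succ_def)
    qed
    finally show "(dn_matrix n * dn_matrix n) $$ (i, l) = circle_laplacian n $$ (i, l)" .
  qed (simp_all add: dn_matrix_def circle_laplacian_def)
  then show "dn_matrix n ^\<^sub>m 2 = circle_laplacian n"
    using carrier by (simp add: numeral_2_eq_2)
qed

end
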